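(* Let $Q$ be a torsion, commutative RIF loop. Then $Q$ is the direct product of a C $2$-loop, a Moufang $3$-loop, and an abelian group in which each element has order prime to $6$.
   Context: A loop is a set $Q$ with a binary operation with neutral element $1$ such that for all $a,b\in Q$ the equations $ax=b$ and $ya=b$ have unique solutions $x,y\in Q$. A loop is an inverse property (IP) loop if each $x$ has a (two-sided) inverse $x^{-1}$ with $x^{-1}(xy)=y$ and $(yx)x^{-1}=y$ for all $y$. A RIF loop is an IP loop satisfying either, and hence both, of the (equivalent) identities $((xy)z)(xy)=x(y((zx)y))$ and $(xy)(z(xy))=((x(yz))x)y$. It is known that RIF loops are diassociative, i.e., any two elements generate a subgroup; so powers and the order $|x|$ of an element are well defined. A loop is torsion if every element has finite order. For a prime $p$, a $p$-loop is a (power-associative) loop in which the order of every element is a power of $p$. A C loop is a loop satisfying $x(y(yz))=((xy)y)z$; a C $2$-loop is a C loop which is a $2$-loop. A Moufang loop is a loop satisfying any, and hence all, of the equivalent identities $x((yz)x)=(xy)(zx)$, $(x(yz))x=(xy)(zx)$, $x(y(xz))=((xy)x)z$, $((zx)y)x=z(x(yx))$; a Moufang $3$-loop is a Moufang loop which is a $3$-loop. A loop $Q$ is the (internal) direct product of subloops $Q_i$, $i\in I$, if each $Q_i$ is normal in $Q$ (a kernel of a loop homomorphism on $Q$), $Q_i\cap\langle Q_j : j\neq i\rangle=1$ for each $i$, and $Q=\langle Q_i : i\in I\rangle$, where $\langle\ \rangle$ denotes the generated subloop; for finite $I$ this is isomorphic to the external direct product. *)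

theory Defs
  imports "HOL-Algebra.Algebra"
begin

(* Loops are HOL-Algebra "monoid" records (carrier, multiplication, one); the record
   type itself imposes no law, so nothing is associative unless stated. *)

locale loop =
  fixes Q :: "('a, 'b) monoid_scheme" (structure)
  assumes m_closed: "\<lbrakk>x \<in> carrier Q; y \<in> carrier Q\<rbrakk> \<Longrightarrow> x \<otimes> y \<in> carrier Q"
    and one_closed: "\<one> \<in> carrier Q"
    and l_one: "x \<in> carrier Q \<Longrightarrow> \<one> \<otimes> x = x"
    and r_one: "x \<in> carrier Q \<Longrightarrow> x \<otimes> \<one> = x"
    and left_div: "\<lbrakk>a \<in> carrier Q; b \<in> carrier Q\<rbrakk> \<Longrightarrow> \<exists>!x. x \<in> carrier Q \<and> a \<otimes> x = b"
    and right_div: "\<lbrakk>a \<in> carrier Q; b \<in> carrier Q\<rbrakk> \<Longrightarrow> \<exists>!y. y \<in> carrier Q \<and> y \<otimes> a = b"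

locale comm_loop = loop +
  assumes m_comm: "\<lbrakk>x \<in> carrier Q; y \<in> carrier Q\<rbrakk> \<Longrightarrow> x \<otimes> y = y \<otimes> x"

locale ip_loop = loop +
  assumes inverse_property:
    "x \<in> carrier Q \<Longrightarrow>
      \<exists>x' \<in> carrier Q. x \<otimes> x' = \<one> \<and> x' \<otimes> x = \<one> \<and>
        (\<forall>y \<in> carrier Q. x' \<otimes> (x \<otimes> y) = y \<and> (y \<otimes> x) \<otimes> x' = y)"

(* The two identities are equivalent in IP loops; a RIF loop satisfies either one. *)
locale rif_loop = ip_loop +
  assumes rif:
    "(\<forall>x \<in> carrier Q. \<forall>y \<in> carrier Q. \<forall>z \<in> carrier Q.
        ((x \<otimes> y) \<otimes> z) \<otimes> (x \<otimes> y) = x \<otimes> (y \<otimes> ((z \<otimes> x) \<otimes> y))) \<or>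
     (\<forall>x \<in> carrier Q. \<forall>y \<in> carrier Q. \<forall>z \<in> carrier Q.
        (x \<otimes> y) \<otimes> (z \<otimes> (x \<otimes> y)) = ((x \<otimes> (y \<otimes> z)) \<otimes> x) \<otimes> y)"

locale c_loop = loop +
  assumes c_identity:
    "\<lbrakk>x \<in> carrier Q; y \<in> carrier Q; z \<in> carrier Q\<rbrakk> \<Longrightarrow>
      x \<otimes> (y \<otimes> (y \<otimes> z)) = ((x \<otimes> y) \<otimes> y) \<otimes> z"

(* The four identities are equivalent in any loop; all of them are required here. *)
locale moufang_loop = loop +
  assumes moufang1:
    "\<lbrakk>x \<in> carrier Q; y \<in> carrier Q; z \<in> carrier Q\<rbrakk> \<Longrightarrow>
      x \<otimes> ((y \<otimes> z) \<otimes> x) = (x \<otimes> y) \<otimes> (z \<otimes> x)"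
    and moufang2:
    "\<lbrakk>x \<in> carrier Q; y \<in> carrier Q; z \<in> carrier Q\<rbrakk> \<Longrightarrow>
      (x \<otimes> (y \<otimes> z)) \<otimes> x = (x \<otimes> y) \<otimes> (z \<otimes> x)"
    and moufang3:
    "\<lbrakk>x \<in> carrier Q; y \<in> carrier Q; z \<in> carrier Q\<rbrakk> \<Longrightarrow>
      x \<otimes> (y \<otimes> (x \<otimes> z)) = ((x \<otimes> y) \<otimes> x) \<otimes> z"
    and moufang4:
    "\<lbrakk>x \<in> carrier Q; y \<in> carrier Q; z \<in> carrier Q\<rbrakk> \<Longrightarrow>
      ((z \<otimes> x) \<otimes> y) \<otimes> x = z \<otimes> (x \<otimes> (y \<otimes> x))"

definition subloop :: "'a set \<Rightarrow> ('a, 'b) monoid_scheme \<Rightarrow> bool" where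
  "subloop H Q \<longleftrightarrow> H \<subseteq> carrier Q \<and> loop (Q\<lparr>carrier := H\<rparr>)"

definition generated_subloop :: "('a, 'b) monoid_scheme \<Rightarrow> 'a set \<Rightarrow> 'a set" where
  "generated_subloop Q S = \<Inter>{H. subloop H Q \<and> S \<subseteq> H}"

(* HOL-Algebra's nat power is left-normed, x [^] (n + 1) = (x [^] n) x; the order is the
   exponent of the least positive power equal to one, with 0 standing for infinite order.
   It is only meaningful in power-associative loops. *)
definition loop_ord :: "('a, 'b) monoid_scheme \<Rightarrow> 'a \<Rightarrow> nat" where
  "loop_ord Q x =
    (if \<exists>n>0. x [^]\<^bsub>Q\<^esub> (n::nat) = \<one>\<^bsub>Q\<^esub>
     then LEAST n. 0 < n \<and> x [^]\<^bsub>Q\<^esub> (n::nat) = \<one>\<^bsub>Q\<^esub> else 0)"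

definition torsion_loop :: "('a, 'b) monoid_scheme \<Rightarrow> bool" where
  "torsion_loop Q \<longleftrightarrow> loop Q \<and> (\<forall>x \<in> carrier Q. 0 < loop_ord Q x)"

definition power_associative :: "('a, 'b) monoid_scheme \<Rightarrow> bool" where
  "power_associative Q \<longleftrightarrow>
    (\<forall>x \<in> carrier Q. group (Q\<lparr>carrier := generated_subloop Q {x}\<rparr>))"

definition p_loop :: "nat \<Rightarrow> ('a, 'b) monoid_scheme \<Rightarrow> bool" where
  "p_loop p Q \<longleftrightarrow> Factorial_Ring.prime p \<and> loop Q \<and> power_associative Q \<and>
    (\<forall>x \<in> carrier Q. \<exists>k. loop_ord Q x = p ^ k)"

(* The codomain lives on 'a set because HOL cannot quantify over its type; by
   normal_subloopI below, kernels of homomorphisms into loops of any type qualify. *)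
definition normal_subloop :: "'a set \<Rightarrow> ('a, 'b) monoid_scheme \<Rightarrow> bool" where
  "normal_subloop H Q \<longleftrightarrow>
    subloop H Q \<and> (\<exists>L :: 'a set monoid. \<exists>f \<in> hom Q L. loop L \<and> H = kernel Q L f)"

definition internal_direct_product ::
    "('a, 'b) monoid_scheme \<Rightarrow> 'i set \<Rightarrow> ('i \<Rightarrow> 'a set) \<Rightarrow> bool" where
  "internal_direct_product Q I H \<longleftrightarrow>
    (\<forall>i \<in> I. normal_subloop (H i) Q) \<and>
    (\<forall>i \<in> I. H i \<inter> generated_subloop Q (\<Union>j \<in> I - {i}. H j) = {\<one>\<^bsub>Q\<^esub>}) \<and>
    carrier Q = generated_subloop Q (\<Union>i \<in> I. H i)"

lemma loop_hom_one:
  assumes Q: "loop Q" and L: "loop L" and f: "f \<in> hom Q L"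
  shows "f \<one>\<^bsub>Q\<^esub> = \<one>\<^bsub>L\<^esub>"
proof -
  interpret Q: loop Q by (rule Q)
  interpret L: loop L by (rule L)
  let ?e = "f \<one>\<^bsub>Q\<^esub>"
  have e: "?e \<in> carrier L" using f Q.one_closed by (auto simp: hom_def)
  have "?e \<otimes>\<^bsub>L\<^esub> ?e = ?e"
    using hom_mult[OF f Q.one_closed Q.one_closed] Q.l_one[OF Q.one_closed] by simp
  then show ?thesis using L.left_div[OF e e] L.r_one[OF e] e L.one_closed by blast
qed

lemma kernel_subloop:
  assumes Q: "loop Q" and L: "loop L" and f: "f \<in> hom Q L"
  shows "subloop (kernel Q L f) Q"
proof -
  interpret Q: loop Q by (rule Q)
  interpret L: loop L by (rule L)
  note f1 = loop_hom_one[OF Q L f]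
  have fm: "f (x \<otimes>\<^bsub>Q\<^esub> y) = f x \<otimes>\<^bsub>L\<^esub> f y" if "x \<in> carrier Q" "y \<in> carrier Q" for x y
    using hom_mult[OF f that] .
  have fc: "f x \<in> carrier L" if "x \<in> carrier Q" for x
    using f that by (auto simp: hom_def)
  have ld: "x \<in> kernel Q L f"
    if "a \<in> kernel Q L f" "b \<in> kernel Q L f" "x \<in> carrier Q" "a \<otimes>\<^bsub>Q\<^esub> x = b" for a b x
    using that fm[of a x] L.l_one[OF fc[of x]] by (auto simp: kernel_def)
  have rd: "x \<in> kernel Q L f"
    if "a \<in> kernel Q L f" "b \<in> kernel Q L f" "x \<in> carrier Q" "x \<otimes>\<^bsub>Q\<^esub> a = b" for a b x
    using that fm[of x a] L.r_one[OF fc[of x]] by (auto simp: kernel_def)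
  have sub: "kernel Q L f \<subseteq> carrier Q" by (auto simp: kernel_def)
  have "loop (Q\<lparr>carrier := kernel Q L f\<rparr>)"
  proof (unfold_locales, goal_cases)
    case (1 x y)
    then show ?case using fm[of x y] L.l_one[OF L.one_closed] Q.m_closed
      by (auto simp: kernel_def)
  next
    case 2 then show ?case using f1 Q.one_closed by (auto simp: kernel_def)
  next
    case (3 x) then show ?case using sub Q.l_one by auto
  next
    case (4 x) then show ?case using sub Q.r_one by auto
  next
    case (5 a b)
    then have ab: "a \<in> kernel Q L f" "b \<in> kernel Q L f" by auto
    then have "\<exists>!x. x \<in> carrier Q \<and> a \<otimes>\<^bsub>Q\<^esub> x = b" using Q.left_div sub by blast
    then show ?case using ld[OF ab] sub by (simp, blast)
  next
    case (6 a b)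
    then have ab: "a \<in> kernel Q L f" "b \<in> kernel Q L f" by auto
    then have "\<exists>!x. x \<in> carrier Q \<and> x \<otimes>\<^bsub>Q\<^esub> a = b" using Q.right_div sub by blast
    then show ?case using rd[OF ab] sub by (simp, blast)
  qed
  then show ?thesis using sub by (simp add: subloop_def)
qed

lemma normal_subloopI:
  fixes Q :: "('a, 'b) monoid_scheme" and L :: "('c, 'd) monoid_scheme"
  assumes Q: "loop Q" and L: "loop L" and f: "f \<in> hom Q L"
  shows "normal_subloop (kernel Q L f) Q"
proof -
  interpret Q: loop Q by (rule Q)
  interpret L: loop L by (rule L)
  note f1 = loop_hom_one[OF Q L f]
  have fm: "f (x \<otimes>\<^bsub>Q\<^esub> y) = f x \<otimes>\<^bsub>L\<^esub> f y" if "x \<in> carrier Q" "y \<in> carrier Q" for x y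
    using hom_mult[OF f that] .
  have fc: "f x \<in> carrier L" if "x \<in> carrier Q" for x
    using f that by (auto simp: hom_def)
  define g where "g u = {x \<in> carrier Q. f x = u}" for u
  define r where "r A = f (SOME x. x \<in> A)" for A
  have rg: "r (g (f x)) = f x" if "x \<in> carrier Q" for x
  proof -
    have "x \<in> g (f x)" using that by (simp add: g_def)
    then have "(SOME y. y \<in> g (f x)) \<in> g (f x)" by (rule someI)
    then show ?thesis by (simp add: r_def g_def)
  qed
  have gi: "f x = f y" if "x \<in> carrier Q" "y \<in> carrier Q" "g (f x) = g (f y)" for x y
    using rg that by metis
  define M :: "'a set monoid" where
    "M = \<lparr>carrier = (\<lambda>x. g (f x)) ` carrier Q, monoid.mult = (\<lambda>A B. g (r A \<otimes>\<^bsub>L\<^esub> r B)), one = g \<one>\<^bsub>L\<^esub>\<rparr>"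
  have cM: "carrier M = (\<lambda>x. g (f x)) ` carrier Q" by (simp add: M_def)
  have oM: "\<one>\<^bsub>M\<^esub> = g (f \<one>\<^bsub>Q\<^esub>)" by (simp add: M_def f1)
  have mM: "g (f x) \<otimes>\<^bsub>M\<^esub> g (f y) = g (f (x \<otimes>\<^bsub>Q\<^esub> y))" if "x \<in> carrier Q" "y \<in> carrier Q" for x y
    using that by (simp add: M_def rg fm)
  have M: "loop M"
  proof (unfold_locales, goal_cases)
    case (1 x y) then show ?case using mM Q.m_closed by (auto simp: cM)
  next
    case 2 then show ?case using oM Q.one_closed by (auto simp: cM)
  next
    case (3 x) then show ?case using mM[OF Q.one_closed] Q.l_one oM by (auto simp: cM)
  next
    case (4 x) then show ?case using mM[OF _ Q.one_closed] Q.r_one oM by (auto simp: cM)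
  next
    case (5 A B)
    then obtain a b where a: "a \<in> carrier Q" "A = g (f a)" and b: "b \<in> carrier Q" "B = g (f b)"
      by (auto simp: cM)
    obtain x where x: "x \<in> carrier Q" "a \<otimes>\<^bsub>Q\<^esub> x = b" using Q.left_div a b by blast
    show ?case
    proof (rule ex1I[of _ "g (f x)"])
      show "g (f x) \<in> carrier M \<and> A \<otimes>\<^bsub>M\<^esub> g (f x) = B" using x a b mM by (auto simp: cM)
    next
      fix Y assume Y: "Y \<in> carrier M \<and> A \<otimes>\<^bsub>M\<^esub> Y = B"
      then obtain y where y: "y \<in> carrier Q" "Y = g (f y)" by (auto simp: cM)
      have "g (f (a \<otimes>\<^bsub>Q\<^esub> y)) = g (f b)" using Y y a b mM by auto
      then have "f (a \<otimes>\<^bsub>Q\<^esub> y) = f b" using gi a b y Q.m_closed by blast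
      then have "f a \<otimes>\<^bsub>L\<^esub> f y = f a \<otimes>\<^bsub>L\<^esub> f x" using fm a y x by metis
      then have "f y = f x" using L.left_div[OF fc[OF a(1)] L.m_closed[OF fc[OF a(1)] fc[OF x(1)]]]
          fc[OF x(1)] fc[OF y(1)] by blast
      then show "Y = g (f x)" using y by simp
    qed
  next
    case (6 A B)
    then obtain a b where a: "a \<in> carrier Q" "A = g (f a)" and b: "b \<in> carrier Q" "B = g (f b)"
      by (auto simp: cM)
    obtain x where x: "x \<in> carrier Q" "x \<otimes>\<^bsub>Q\<^esub> a = b" using Q.right_div a b by blast
    show ?case
    proof (rule ex1I[of _ "g (f x)"])
      show "g (f x) \<in> carrier M \<and> g (f x) \<otimes>\<^bsub>M\<^esub> A = B" using x a b mM by (auto simp: cM)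
    next
      fix Y assume Y: "Y \<in> carrier M \<and> Y \<otimes>\<^bsub>M\<^esub> A = B"
      then obtain y where y: "y \<in> carrier Q" "Y = g (f y)" by (auto simp: cM)
      have "g (f (y \<otimes>\<^bsub>Q\<^esub> a)) = g (f b)" using Y y a b mM by auto
      then have "f (y \<otimes>\<^bsub>Q\<^esub> a) = f b" using gi a b y Q.m_closed by blast
      then have "f y \<otimes>\<^bsub>L\<^esub> f a = f x \<otimes>\<^bsub>L\<^esub> f a" using fm a y x by metis
      then have "f y = f x" using L.right_div[OF fc[OF a(1)] L.m_closed[OF fc[OF x(1)] fc[OF a(1)]]]
          fc[OF x(1)] fc[OF y(1)] by blast
      then show "Y = g (f x)" using y by simp
    qed
  qed
  have h: "(\<lambda>x. g (f x)) \<in> hom Q M" using mM by (auto simp: hom_def cM)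
  have "kernel Q L f = kernel Q M (\<lambda>x. g (f x))"
    using gi f1 oM Q.one_closed by (force simp: kernel_def)
  then show ?thesis
    using kernel_subloop[OF Q L f] M h by (auto simp: normal_subloop_def)
qed

end

(* Let L(x) be translation by x. A commutative RIF loop is a commutative IP loop with
   L(xy)^2 = L(x) L(y)^2 L(x). This law gives L(x^n) = L(x)^n and (xy)^n = x^n y^n by two-step
   inductions, so the power maps are endomorphisms and the torsion parts split off. It also makes
   every square a Moufang element, whence sixth powers are nuclear. Elements of the 2-part are
   cubes, so their squares are nuclear and the C law holds; elements of the 3-part are squares,
   hence Moufang; elements of order prime to 6 are sixth powers, hence nuclear. *)

theory Submission
  imports Defs "HOL-Number_Theory.Cong"
begin

section \<open>Loops and subloops\<close>

text \<open>The law controls only squares of translations, which is why exponents advance two at a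
  time and why squares are the first elements to behave well. A Moufang element A may translate both
  factors of a product at the price of translating the product twice. In an inverse property loop
  this rotates: A acts twice on one factor, inversely on the other, once on the product. In the
  composite the second factor is left alone and A acts three times on the first. Hence the constant
  6 = 2 * 3 and the special role of the primes 2 and 3. For the splitting, the obstacle is that
  orders may be unbounded, so no single power map need project onto a torsion part: the exponent
  varies with the element. The projection is therefore given by a relation that determines its
  value, and two values are compared by raising to a common exponent.\<close>

lemma group_imp_loop:
  assumes "group G"
  shows "loop G"
proof -
  interpret group G by (rule assms)
  show ?thesis
  proof
    fix a b assume a: "a \<in> carrier G" and b: "b \<in> carrier G"
    show "\<exists>!x. x \<in> carrier G \<and> a \<otimes>\<^bsub>G\<^esub> x = b"
      using a b by (intro ex1I[of _ "inv\<^bsub>G\<^esub> a \<otimes>\<^bsub>G\<^esub> b"]) (auto simp: m_assoc[symmetric])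
    show "\<exists>!y. y \<in> carrier G \<and> y \<otimes>\<^bsub>G\<^esub> a = b"
      using a b by (intro ex1I[of _ "b \<otimes>\<^bsub>G\<^esub> inv\<^bsub>G\<^esub> a"]) (auto simp: m_assoc)
  qed auto
qed

lemma subloop_one: "subloop H Q \<Longrightarrow> \<one>\<^bsub>Q\<^esub> \<in> H"
  using loop.one_closed by (fastforce simp: subloop_def)

lemma subloop_mult: "\<lbrakk>subloop H Q; x \<in> H; y \<in> H\<rbrakk> \<Longrightarrow> x \<otimes>\<^bsub>Q\<^esub> y \<in> H"
  using loop.m_closed by (fastforce simp: subloop_def)

lemma subloop_pow:
  assumes "subloop H Q" "x \<in> H"
  shows "x [^]\<^bsub>Q\<^esub> (n::nat) \<in> H"
  using assms by (induction n) (auto simp: nat_pow_def subloop_one subloop_mult)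

lemma subloop_right_inverse:
  assumes "subloop H Q" "x \<in> H"
  shows "\<exists>y \<in> H. x \<otimes>\<^bsub>Q\<^esub> y = \<one>\<^bsub>Q\<^esub>"
proof -
  interpret H: loop "Q\<lparr>carrier := H\<rparr>" using assms(1) by (simp add: subloop_def)
  show ?thesis using H.left_div[of x "\<one>\<^bsub>Q\<^esub>"] H.one_closed assms(2) by auto
qed

lemma generated_subloop_least: "\<lbrakk>subloop H Q; S \<subseteq> H\<rbrakk> \<Longrightarrow> generated_subloop Q S \<subseteq> H"
  by (auto simp: generated_subloop_def)

lemma one_in_generated_subloop: "\<one>\<^bsub>Q\<^esub> \<in> generated_subloop Q S"
  by (auto simp: generated_subloop_def subloop_one)

lemma nat_pow_carrier_update: "x [^]\<^bsub>Q\<lparr>carrier := H\<rparr>\<^esub> (n::nat) = x [^]\<^bsub>Q\<^esub> n"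
  by (simp add: nat_pow_def)

lemma loop_ord_carrier_update: "loop_ord (Q\<lparr>carrier := H\<rparr>) x = loop_ord Q x"
  by (simp add: loop_ord_def nat_pow_carrier_update cong: if_cong)

lemma pow_loop_ord:
  assumes "0 < loop_ord Q x"
  shows "x [^]\<^bsub>Q\<^esub> loop_ord Q x = \<one>\<^bsub>Q\<^esub>"
proof -
  have ex: "\<exists>n>0. x [^]\<^bsub>Q\<^esub> (n::nat) = \<one>\<^bsub>Q\<^esub>"
  proof (rule ccontr)
    assume "\<not> ?thesis"
    then have "loop_ord Q x = 0" unfolding loop_ord_def by (rule if_not_P)
    then show False using assms by simp
  qed
  then have "loop_ord Q x = (LEAST n. 0 < n \<and> x [^]\<^bsub>Q\<^esub> (n::nat) = \<one>\<^bsub>Q\<^esub>)"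
    unfolding loop_ord_def by (rule if_P)
  then show ?thesis using LeastI_ex[OF ex] by simp
qed

section \<open>Commutative RIF loops\<close>

locale comm_rif_loop = rif_loop Q + comm_loop Q for Q :: "('a, 'b) monoid_scheme" (structure)
begin

text \<open>\<open>inv\<close> is a definite description, so the witness of the inverse property
  must be identified with it; uniqueness comes from left division.\<close>

lemma inv_properties:
  assumes x: "x \<in> carrier Q"
  shows "inv x \<in> carrier Q" "x \<otimes> inv x = \<one>" "inv x \<otimes> x = \<one>"
    "y \<in> carrier Q \<Longrightarrow> inv x \<otimes> (x \<otimes> y) = y" "y \<in> carrier Q \<Longrightarrow> (y \<otimes> x) \<otimes> inv x = y"
proof -
  obtain z where z: "z \<in> carrier Q" "x \<otimes> z = \<one>" "z \<otimes> x = \<one>"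
    "\<And>y. y \<in> carrier Q \<Longrightarrow> z \<otimes> (x \<otimes> y) = y" "\<And>y. y \<in> carrier Q \<Longrightarrow> (y \<otimes> x) \<otimes> z = y"
    using inverse_property[OF x] by auto
  have "inv x = z"
    unfolding m_inv_def using z x left_div[OF x one_closed]
    by (intro the_equality) auto
  with z show "inv x \<in> carrier Q" "x \<otimes> inv x = \<one>" "inv x \<otimes> x = \<one>"
    "y \<in> carrier Q \<Longrightarrow> inv x \<otimes> (x \<otimes> y) = y" "y \<in> carrier Q \<Longrightarrow> (y \<otimes> x) \<otimes> inv x = y"
    by auto
qed

lemmas closed = m_closed one_closed inv_properties(1)

lemma l_cancel:
  assumes "x \<in> carrier Q" "y \<in> carrier Q" "z \<in> carrier Q" "x \<otimes> y = x \<otimes> z"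
  shows "y = z"
  using assms inv_properties(4) by metis

lemma inv_inv: "x \<in> carrier Q \<Longrightarrow> inv (inv x) = x"
  using l_cancel[of "inv x" "inv (inv x)" x] inv_properties by simp

lemma mult_inv_cancel:
  assumes "x \<in> carrier Q" "y \<in> carrier Q"
  shows "x \<otimes> (inv x \<otimes> y) = y"
  using inv_properties(4)[of "inv x" y] inv_inv assms inv_properties(1) by simp

lemma inv_mult:
  assumes x: "x \<in> carrier Q" and y: "y \<in> carrier Q"
  shows "inv (x \<otimes> y) = inv x \<otimes> inv y"
proof -
  have "inv (x \<otimes> y) \<otimes> x = inv y"
    using inv_properties(4)[of "x \<otimes> y" "inv y"] inv_properties(5)[of y x] x y closed by simp
  then show ?thesis
    using inv_properties(5)[of x "inv (x \<otimes> y)"] m_comm x y closed by metis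
qed

text \<open>In the presence of commutativity both RIF identities say
  \<open>L\<^sub>x\<^sub>y\<^sup>2 = L\<^sub>x L\<^sub>y\<^sup>2 L\<^sub>x\<close> for the translations \<open>L\<^sub>x y = x \<otimes> y\<close>.\<close>

lemma rif_comm:
  assumes x: "x \<in> carrier Q" and y: "y \<in> carrier Q" and z: "z \<in> carrier Q"
  shows "(x \<otimes> y) \<otimes> ((x \<otimes> y) \<otimes> z) = x \<otimes> (y \<otimes> (y \<otimes> (x \<otimes> z)))"
  using rif
proof
  assume "\<forall>x\<in>carrier Q. \<forall>y\<in>carrier Q. \<forall>z\<in>carrier Q.
    ((x \<otimes> y) \<otimes> z) \<otimes> (x \<otimes> y) = x \<otimes> (y \<otimes> ((z \<otimes> x) \<otimes> y))"
  then have "((x \<otimes> y) \<otimes> z) \<otimes> (x \<otimes> y) = x \<otimes> (y \<otimes> ((z \<otimes> x) \<otimes> y))" using x y z by blast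
  moreover have "((x \<otimes> y) \<otimes> z) \<otimes> (x \<otimes> y) = (x \<otimes> y) \<otimes> ((x \<otimes> y) \<otimes> z)"
    using x y z by (intro m_comm m_closed)
  moreover have "(z \<otimes> x) \<otimes> y = y \<otimes> (x \<otimes> z)" using x y z m_comm m_closed by metis
  ultimately show ?thesis by simp
next
  assume "\<forall>x\<in>carrier Q. \<forall>y\<in>carrier Q. \<forall>z\<in>carrier Q.
    (x \<otimes> y) \<otimes> (z \<otimes> (x \<otimes> y)) = ((x \<otimes> (y \<otimes> z)) \<otimes> x) \<otimes> y"
  then have "(y \<otimes> x) \<otimes> (z \<otimes> (y \<otimes> x)) = ((y \<otimes> (x \<otimes> z)) \<otimes> y) \<otimes> x" using x y z by blast
  moreover have "((y \<otimes> (x \<otimes> z)) \<otimes> y) \<otimes> x = x \<otimes> (y \<otimes> (y \<otimes> (x \<otimes> z)))"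
    using x y z m_comm m_closed by metis
  moreover have "y \<otimes> x = x \<otimes> y" "z \<otimes> (x \<otimes> y) = (x \<otimes> y) \<otimes> z"
    using x y z by (auto intro: m_comm m_closed)
  ultimately show ?thesis by simp
qed

section \<open>Powers as iterated translations, and their multiplicativity\<close>

declare nat_pow_Suc [simp del]

lemma pow_closed: "x \<in> carrier Q \<Longrightarrow> x [^] (n::nat) \<in> carrier Q"
  by (induction n) (auto simp: nat_pow_def closed)

lemma pow_Suc:
  assumes "x \<in> carrier Q"
  shows "x [^] Suc n = x \<otimes> x [^] n"
  using m_comm[OF pow_closed[of x n] assms] assms by (simp add: nat_pow_def)

lemma pow_1: "x \<in> carrier Q \<Longrightarrow> x [^] (1::nat) = x"
  using pow_Suc[of x 0] by (simp add: r_one)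

lemmas pow_Suc_0 = pow_1[unfolded One_nat_def]

lemma funpow_closed:
  "\<lbrakk>a \<in> carrier Q; b \<in> carrier Q\<rbrakk> \<Longrightarrow> (((\<otimes>) a) ^^ n) b \<in> carrier Q"
  by (induction n) (auto simp: m_closed)

text \<open>The law is evaluated at \<open>z = a [^] k \<otimes> inv b\<close>, chosen so that the
  inner \<open>b\<close> cancels. The two smaller cases, used at \<open>inv b\<close> and
  \<open>u\<close>, show that \<open>b \<otimes> a\<close> takes this \<open>z\<close> to
  \<open>a [^] Suc k\<close>, which accounts for one of the two translations by
  \<open>b \<otimes> a\<close>. As the induction hypotheses are needed at several arguments,
  \<open>b\<close> stays arbitrary.\<close>

lemma pow_mult_conv_funpow:
  assumes a: "a \<in> carrier Q" and "b \<in> carrier Q"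
  shows "a [^] n \<otimes> b = (((\<otimes>) a) ^^ n) b"
  using assms(2)
proof (induction n arbitrary: b rule: induct_nat_012)
  case (ge2 k b)
  note b = \<open>b \<in> carrier Q\<close>
  define u where "u = inv (b \<otimes> a)"
  have u: "u \<in> carrier Q" "inv u = b \<otimes> a"
    using a b by (auto simp: u_def closed inv_inv)
  have au: "a \<otimes> u = inv b"
    using a b mult_inv_cancel[of a "inv b"] m_comm[of "inv a" "inv b"]
    by (simp add: u_def inv_mult closed)
  have "a [^] Suc k \<otimes> u = a [^] k \<otimes> inv b"
    using ge2.IH a b u by (simp add: funpow_swap1 closed au)
  moreover have "a [^] Suc k \<otimes> u \<otimes> (b \<otimes> a) = a [^] Suc k"
    using inv_properties(5)[of u "a [^] Suc k"] u a pow_closed by simp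
  ultimately have *: "(b \<otimes> a) \<otimes> (a [^] k \<otimes> inv b) = a [^] Suc k"
    using m_comm a b closed pow_closed by metis
  have "a [^] Suc k \<otimes> (a \<otimes> b) = (b \<otimes> a) \<otimes> ((b \<otimes> a) \<otimes> (a [^] k \<otimes> inv b))"
    unfolding * using m_comm a b closed pow_closed by metis
  also have "\<dots> = b \<otimes> (a \<otimes> (a \<otimes> (b \<otimes> (a [^] k \<otimes> inv b))))"
    using a b by (intro rif_comm) (auto simp: closed pow_closed)
  also have "b \<otimes> (a [^] k \<otimes> inv b) = a [^] k"
    using mult_inv_cancel[of b "a [^] k"] m_comm[of "a [^] k" "inv b"] a b
    by (simp add: closed pow_closed)
  also have "b \<otimes> (a \<otimes> (a \<otimes> a [^] k)) = a [^] Suc (Suc k) \<otimes> b"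
    using m_comm[OF b pow_closed[OF a, of "Suc (Suc k)"]] a by (simp add: pow_Suc pow_closed)
  finally show ?case
    using ge2.IH(2)[of "a \<otimes> b"] a b by (simp add: funpow_swap1 closed)
qed (use a in \<open>auto simp: l_one pow_Suc_0\<close>)

lemma pow_add_mult:
  fixes m n :: nat
  assumes "a \<in> carrier Q" "b \<in> carrier Q"
  shows "a [^] m \<otimes> (a [^] n \<otimes> b) = a [^] (m + n) \<otimes> b"
  using assms by (simp add: pow_mult_conv_funpow funpow_closed funpow_add)

lemma pow_add:
  fixes m n :: nat
  assumes "a \<in> carrier Q"
  shows "a [^] (m + n) = a [^] m \<otimes> a [^] n"
  using assms pow_add_mult[OF assms one_closed, of m n] by (simp add: r_one pow_closed)

lemma pow_pow:
  fixes m n :: nat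
  assumes "a \<in> carrier Q"
  shows "(a [^] m) [^] n = a [^] (m * n)"
  using assms by (induction n) (auto simp: pow_Suc pow_closed pow_add)

lemma one_pow: "\<one> [^] (n::nat) = \<one>"
  by (induction n) (auto simp: pow_Suc one_closed l_one)

lemma pow_2: "a \<in> carrier Q \<Longrightarrow> a [^] (2::nat) = a \<otimes> a"
  by (simp add: numeral_2_eq_2 pow_Suc r_one)

lemma left_alt: "\<lbrakk>a \<in> carrier Q; b \<in> carrier Q\<rbrakk> \<Longrightarrow> (a \<otimes> a) \<otimes> b = a \<otimes> (a \<otimes> b)"
  using pow_mult_conv_funpow[of a b 2] pow_2[of a] by (simp add: numeral_2_eq_2)

text \<open>Two translations by \<open>a \<otimes> b\<close> applied to the k-th power become the
  word a(b(b(a(a^k b^k)))). Each letter in turn merges into a power by \<open>pow_add_mult\<close>,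
  after commuting the factors where necessary.\<close>

lemma mult_pow:
  fixes n :: nat
  assumes a: "a \<in> carrier Q" and b: "b \<in> carrier Q"
  shows "(a \<otimes> b) [^] n = a [^] n \<otimes> b [^] n"
proof (induction n rule: induct_nat_012)
  case (ge2 k)
  have ac: "a [^] i \<in> carrier Q" "b [^] i \<in> carrier Q" for i :: nat using a b pow_closed by auto
  have "(a \<otimes> b) [^] Suc (Suc k) = (a \<otimes> b) \<otimes> ((a \<otimes> b) \<otimes> (a \<otimes> b) [^] k)"
    using a b by (simp add: pow_Suc closed)
  also have "\<dots> = a \<otimes> (b \<otimes> (b \<otimes> (a \<otimes> (a [^] k \<otimes> b [^] k))))"
    unfolding ge2.IH(1) using a b ac by (intro rif_comm) (auto simp: closed)
  also have "a \<otimes> (a [^] k \<otimes> b [^] k) = b [^] k \<otimes> a [^] Suc k"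
    using pow_add_mult[OF a ac(2), of 1 k k] m_comm[OF ac(1)[of "Suc k"] ac(2)[of k]]
    by (simp add: pow_Suc_0[OF a])
  also have "b \<otimes> (b \<otimes> (b [^] k \<otimes> a [^] Suc k)) = a [^] Suc k \<otimes> b [^] Suc (Suc k)"
    using pow_add_mult[OF b ac(1), of 1 k "Suc k"] pow_add_mult[OF b ac(1), of 1 "Suc k" "Suc k"]
      m_comm[OF ac(1)[of "Suc k"] ac(2)[of "Suc (Suc k)"]]
    by (simp add: pow_Suc_0[OF b])
  also have "a \<otimes> (a [^] Suc k \<otimes> b [^] Suc (Suc k)) = a [^] Suc (Suc k) \<otimes> b [^] Suc (Suc k)"
    using pow_add_mult[OF a ac(2), of 1 "Suc k" "Suc (Suc k)"]
    by (simp add: pow_Suc_0[OF a])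
  finally show ?case .
qed (use a b in \<open>auto simp: l_one one_closed pow_Suc_0 m_closed\<close>)

section \<open>Squares are Moufang and sixth powers are nuclear\<close>

text \<open>This is the law with its squared translations replaced by translations by squares:
  \<open>left_alt\<close> does this on both sides, and \<open>mult_pow\<close> splits the square of
  \<open>x \<otimes> a\<close>.\<close>

lemma square_mult_middle:
  assumes a: "a \<in> carrier Q" and x: "x \<in> carrier Q" and z: "z \<in> carrier Q"
  shows "x \<otimes> ((a \<otimes> a) \<otimes> (x \<otimes> z)) = ((x \<otimes> x) \<otimes> (a \<otimes> a)) \<otimes> z"
proof -
  have "x \<otimes> ((a \<otimes> a) \<otimes> (x \<otimes> z)) = x \<otimes> (a \<otimes> (a \<otimes> (x \<otimes> z)))"
    using assms by (simp add: left_alt closed)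
  also have "\<dots> = (x \<otimes> a) \<otimes> ((x \<otimes> a) \<otimes> z)"
    using rif_comm[OF x a z] by simp
  also have "\<dots> = ((x \<otimes> x) \<otimes> (a \<otimes> a)) \<otimes> z"
    using mult_pow[OF x a, of 2] assms by (simp add: left_alt[symmetric] pow_2 closed)
  finally show ?thesis .
qed

text \<open>Supplies the inner value needed for \<open>square_moufang\<close>. Writing
  \<open>b\<close> as \<open>?p \<otimes> inv c\<close> makes \<open>square_mult_middle\<close>
  applicable; expanding the square of \<open>?p = c \<otimes> b\<close> by the law then exposes an
  outer \<open>c\<close> that cancels \<open>inv c\<close>.\<close>

lemma mult_square_mult:
  assumes a: "a \<in> carrier Q" and b: "b \<in> carrier Q" and c: "c \<in> carrier Q"
  shows "(b \<otimes> (a \<otimes> a)) \<otimes> (b \<otimes> c) = (b \<otimes> b) \<otimes> (c \<otimes> (a \<otimes> a))"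
proof -
  let ?A = "a \<otimes> a" and ?p = "c \<otimes> b"
  have cl: "?A \<in> carrier Q" "?p \<in> carrier Q" "inv c \<in> carrier Q" using a b c closed by auto
  have pb: "?p \<otimes> inv c = b"
    using inv_properties(5)[OF c b] m_comm[OF b c] by simp
  have "(b \<otimes> ?A) \<otimes> (b \<otimes> c) = ?p \<otimes> (?A \<otimes> b)"
    using m_comm[OF b c] m_comm[OF b cl(1)] m_comm[of "b \<otimes> ?A" "b \<otimes> c"] a b c
    by (simp add: closed)
  also have "\<dots> = ((?p \<otimes> ?p) \<otimes> ?A) \<otimes> inv c"
    using square_mult_middle[OF a cl(2,3)] pb by simp
  also have "\<dots> = inv c \<otimes> (c \<otimes> (b \<otimes> (b \<otimes> (c \<otimes> ?A))))"
    using m_comm[OF m_closed[OF m_closed[OF cl(2,2)] cl(1)] cl(3)] rif_comm[OF c b cl(1)] cl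
    by (simp add: left_alt)
  also have "\<dots> = (b \<otimes> b) \<otimes> (c \<otimes> ?A)"
    using inv_properties(4)[OF c] b c cl by (simp add: left_alt closed)
  finally show ?thesis .
qed

text \<open>Apply \<open>L\<^sub>x\<^sub>y\<^sup>2 = L\<^sub>x L\<^sub>y\<^sup>2 L\<^sub>x\<close> to the factorisation \<open>a\<^sup>2 = (b a\<^sup>2) b\<inverse>\<close> and
  evaluate at \<open>b c\<close>.\<close>

lemma square_moufang:
  assumes a: "a \<in> carrier Q" and b: "b \<in> carrier Q" and c: "c \<in> carrier Q"
  shows "((a \<otimes> a) \<otimes> b) \<otimes> ((a \<otimes> a) \<otimes> c) = (a \<otimes> a) \<otimes> ((a \<otimes> a) \<otimes> (b \<otimes> c))"
proof -
  let ?A = "a \<otimes> a" and ?x = "b \<otimes> (a \<otimes> a)"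
  have cl: "?A \<in> carrier Q" "?x \<in> carrier Q" "inv b \<in> carrier Q" "b \<otimes> c \<in> carrier Q"
    "c \<otimes> ?A \<in> carrier Q"
    using a b c closed by auto
  have A: "?x \<otimes> inv b = ?A"
    using inv_properties(5)[OF b cl(1)] m_comm[OF b cl(1)] by simp
  have "?A \<otimes> (?A \<otimes> (b \<otimes> c)) = ?x \<otimes> (inv b \<otimes> (inv b \<otimes> (?x \<otimes> (b \<otimes> c))))"
    using rif_comm[OF cl(2,3,4)] A by simp
  \<comment> \<open>By \<open>mult_square_mult\<close> the innermost product is
    \<open>(b \<otimes> b) \<otimes> (c \<otimes> ?A)\<close>, so both copies of
    \<open>inv b\<close> cancel.\<close>
  also have "inv b \<otimes> (inv b \<otimes> (?x \<otimes> (b \<otimes> c))) = c \<otimes> ?A"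
    using mult_square_mult[OF a b c] inv_properties(4)[OF b] b cl by (simp add: left_alt closed)
  finally show ?thesis
    using m_comm[OF b cl(1)] m_comm[OF c cl(1)] by simp
qed

text \<open>The rotation of an autotopism in an inverse property loop: apply
  \<open>square_moufang\<close> to \<open>b \<otimes> c\<close> and \<open>inv c\<close>, whose
  product is \<open>b\<close>, and divide by the second factor.\<close>

lemma square_moufang_inv:
  assumes a: "a \<in> carrier Q" and b: "b \<in> carrier Q" and c: "c \<in> carrier Q"
  shows "(a \<otimes> a) \<otimes> (b \<otimes> c) = ((a \<otimes> a) \<otimes> ((a \<otimes> a) \<otimes> b)) \<otimes> (inv (a \<otimes> a) \<otimes> c)"
proof -
  let ?A = "a \<otimes> a" and ?d = "inv c"
  have cl: "?A \<in> carrier Q" "?d \<in> carrier Q" "b \<otimes> c \<in> carrier Q" "inv ?A \<in> carrier Q"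
    using a b c closed by auto
  have b': "(b \<otimes> c) \<otimes> ?d = b" using inv_properties(5)[OF c b] .
  have "(?A \<otimes> (b \<otimes> c)) \<otimes> (?A \<otimes> ?d) = ?A \<otimes> (?A \<otimes> b)"
    using square_moufang[OF a cl(3,2)] b' by simp
  then have "?A \<otimes> (b \<otimes> c) = (?A \<otimes> (?A \<otimes> b)) \<otimes> inv (?A \<otimes> ?d)"
    using inv_properties(5)[of "?A \<otimes> ?d" "?A \<otimes> (b \<otimes> c)"] cl by (simp add: closed)
  then show ?thesis using cl c by (simp add: inv_mult inv_inv)
qed

lemma square_moufang_middle:
  assumes a: "a \<in> carrier Q" and b: "b \<in> carrier Q" and c: "c \<in> carrier Q"
  shows "(a \<otimes> a) \<otimes> (b \<otimes> ((a \<otimes> a) \<otimes> c)) = ((a \<otimes> a) \<otimes> ((a \<otimes> a) \<otimes> b)) \<otimes> c"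
  using square_moufang_inv[OF a b, of "(a \<otimes> a) \<otimes> c"] assms
  by (simp add: closed inv_properties(4))

text \<open>For \<open>A\<close> a square, \<open>(L\<^sub>A, L\<^sub>A, L\<^sub>A\<^sup>2)\<close> and \<open>(L\<^sub>A\<^sup>2, L\<^sub>A\<inverse>, L\<^sub>A)\<close> are autotopisms; so is their
  product \<open>(L\<^sub>A\<^sup>3, 1, L\<^sub>A\<^sup>3)\<close>.\<close>

lemma sixth_power_nuclear:
  assumes a: "a \<in> carrier Q" and b: "b \<in> carrier Q" and c: "c \<in> carrier Q"
  shows "a [^] (6::nat) \<otimes> (b \<otimes> c) = (a [^] (6::nat) \<otimes> b) \<otimes> c"
proof -
  let ?A = "a \<otimes> a"
  have A: "?A \<in> carrier Q" "inv ?A \<in> carrier Q" using a closed by auto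
  have six: "a [^] (6::nat) \<otimes> d = ?A \<otimes> (?A \<otimes> (?A \<otimes> d))" if d: "d \<in> carrier Q" for d
    using pow_add_mult[OF a d, of 2 4] pow_add_mult[OF a d, of 2 2] a by (simp add: pow_2)
  have "?A \<otimes> (?A \<otimes> (?A \<otimes> (b \<otimes> c)))
      = ?A \<otimes> (?A \<otimes> ((?A \<otimes> (?A \<otimes> b)) \<otimes> (inv ?A \<otimes> c)))"
    using square_moufang_inv[OF assms] by simp
  also have "\<dots> = (?A \<otimes> (?A \<otimes> (?A \<otimes> b))) \<otimes> (?A \<otimes> (inv ?A \<otimes> c))"
    using a b c A by (intro square_moufang[symmetric]) (auto simp: closed)
  also have "?A \<otimes> (inv ?A \<otimes> c) = c"
    using mult_inv_cancel[OF A(1) c] .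
  finally show ?thesis using b c by (simp add: six closed)
qed

section \<open>Torsion parts\<close>

lemma pow_cong:
  fixes k m n :: nat
  assumes a: "a \<in> carrier Q" and "a [^] k = \<one>" and "[m = n] (mod k)"
  shows "a [^] m = a [^] n"
proof -
  have "a [^] i = a [^] (i mod k)" for i :: nat
  proof -
    have "a [^] i = a [^] (k * (i div k)) \<otimes> a [^] (i mod k)"
      using pow_add[OF a, of "k * (i div k)" "i mod k"] by simp
    also have "a [^] (k * (i div k)) = \<one>"
      using pow_pow[OF a, of k "i div k"] assms(2) by (simp add: one_pow)
    finally show ?thesis using a by (simp add: l_one pow_closed)
  qed
  then show ?thesis using assms(3) by (metis cong_def)
qed

lemma pow_eq_one_dvd:
  fixes k n :: nat
  assumes "a \<in> carrier Q" "a [^] k = \<one>" "k dvd n"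
  shows "a [^] n = \<one>"
  using pow_cong[of a k n 0] assms by (simp add: cong_0_iff)

lemma loop_ord_dvd:
  fixes n :: nat
  assumes a: "a \<in> carrier Q" and n: "a [^] n = \<one>" "0 < n"
  shows "loop_ord Q a dvd n"
proof -
  let ?P = "\<lambda>n. 0 < n \<and> a [^] (n::nat) = \<one>"
  have o: "loop_ord Q a = (LEAST n. ?P n)"
    unfolding loop_ord_def using n by (intro if_P) auto
  have P: "?P (loop_ord Q a)" unfolding o using n by (intro LeastI[of ?P n]) auto
  have "a [^] (n mod loop_ord Q a) = \<one>"
    using pow_cong[OF a, of "loop_ord Q a" "n mod loop_ord Q a" n] P n by (simp add: cong_def)
  moreover have "n mod loop_ord Q a < (LEAST n. ?P n)" using P o by simp
  ultimately have "n mod loop_ord Q a = 0" using not_less_Least[of "n mod loop_ord Q a" ?P] by auto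
  then show ?thesis by auto
qed

text \<open>\<open>k\<close> is invertible modulo \<open>n\<close>, so the root can be taken among
  the powers of \<open>a\<close> itself.\<close>

lemma exists_root:
  fixes k n :: nat
  assumes a: "a \<in> carrier Q" and "a [^] n = \<one>" and "coprime k n"
  shows "\<exists>u::nat. a = (a [^] u) [^] k"
proof -
  obtain u where "[k * u = 1] (mod n)" using cong_solve_coprime_nat[OF assms(3)] by auto
  then have "a [^] (u * k) = a" using pow_cong[OF a assms(2)] a by (simp add: mult.commute pow_Suc_0)
  then show ?thesis using a pow_pow by metis
qed

text \<open>The exponents \<open>n * v\<close> and \<open>m * u\<close> are the Chinese remainder
  idempotents modulo \<open>m * n\<close>: the first is 1 modulo \<open>m\<close> and 0 modulo
  \<open>n\<close>, the second the reverse, so they add up to 1.\<close>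

lemma coprime_decomposition:
  fixes m n :: nat
  assumes x: "x \<in> carrier Q" and "x [^] (m * n) = \<one>" and "coprime m n"
  obtains s t where "s \<in> carrier Q" "t \<in> carrier Q" "x = s \<otimes> t" "s [^] m = \<one>" "t [^] n = \<one>"
proof -
  obtain u where u: "[m * u = 1] (mod n)" using cong_solve_coprime_nat[OF assms(3)] by auto
  obtain v where v: "[n * v = 1] (mod m)"
    using cong_solve_coprime_nat[of n m] assms(3) by (auto simp: coprime_commute)
  have "[n * v + m * u = 1] (mod m)" using cong_add[OF v, of "m * u" 0] by (simp add: cong_0_iff)
  moreover have "[n * v + m * u = 1] (mod n)" using cong_add[of "n * v" 0 n, OF _ u] by (simp add: cong_0_iff)
  ultimately have "[n * v + m * u = 1] (mod m * n)" using assms(3) by (rule coprime_cong_mult_nat)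
  then have "x = x [^] (n * v) \<otimes> x [^] (m * u)"
    using pow_cong[OF x assms(2)] x by (simp add: pow_Suc_0 flip: pow_add)
  moreover have "(x [^] (n * v)) [^] m = \<one>" "(x [^] (m * u)) [^] n = \<one>"
    using pow_eq_one_dvd[OF x assms(2)] x by (auto simp: pow_pow)
  ultimately show thesis using that[of "x [^] (n * v)" "x [^] (m * u)"] x pow_closed by blast
qed

text \<open>A set of exponents, instead of a prime, lets one notion cover both the powers of q and
  the numbers coprime to q, that is, a part and its complement.\<close>

definition torsion_part :: "nat set \<Rightarrow> 'a set" where
  "torsion_part A = {x \<in> carrier Q. \<exists>k \<in> A. x [^] k = \<one>}"

text \<open>As \<open>b\<close> kills \<open>x\<close> and is coprime to \<open>a\<close>, the
  element \<open>x\<close> is a power of \<open>x [^] a\<close>, which is trivial.\<close>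

lemma torsion_part_disjoint:
  assumes "\<And>a b. \<lbrakk>a \<in> A; b \<in> B\<rbrakk> \<Longrightarrow> coprime a b"
  shows "torsion_part A \<inter> torsion_part B \<subseteq> {\<one>}"
proof
  fix x assume "x \<in> torsion_part A \<inter> torsion_part B"
  then obtain a b where x: "x \<in> carrier Q" and a: "a \<in> A" "x [^] a = \<one>"
    and b: "b \<in> B" "x [^] b = \<one>"
    by (auto simp: torsion_part_def)
  obtain u :: nat where "x = (x [^] u) [^] a" using exists_root[OF x b(2) assms[OF a(1) b(1)]] ..
  then have "x = (x [^] a) [^] u" using x by (simp add: pow_pow mult.commute)
  then show "x \<in> {\<one>}" using a by (simp add: one_pow)
qed

text \<open>The \<open>A\<close>-torsion part is the kernel of the projection to the \<open>B\<close>-torsion part,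
  which maps \<open>x\<close> to the unique \<open>y\<close> in the \<open>B\<close>-torsion part that agrees with \<open>x\<close> up to
  \<open>A\<close>-torsion.\<close>

lemma torsion_part_normal:
  assumes A: "1 \<in> A" "\<And>a a'. \<lbrakk>a \<in> A; a' \<in> A\<rbrakk> \<Longrightarrow> a * a' \<in> A"
    and B: "1 \<in> B" "\<And>b b'. \<lbrakk>b \<in> B; b' \<in> B\<rbrakk> \<Longrightarrow> b * b' \<in> B"
    and cop: "\<And>a b. \<lbrakk>a \<in> A; b \<in> B\<rbrakk> \<Longrightarrow> coprime a b"
    and tor: "\<And>x. x \<in> carrier Q \<Longrightarrow> \<exists>a \<in> A. \<exists>b \<in> B. x [^] (a * b) = \<one>"
  shows "normal_subloop (torsion_part A) Q"
proof -
  define R where "R x y \<longleftrightarrow> y \<in> carrier Q \<and> (\<exists>b \<in> B. y [^] b = \<one>) \<and> (\<exists>a \<in> A. x [^] a = y [^] a)" for x y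
  have R_unique: "y = z" if x: "x \<in> carrier Q" and R: "R x y" "R x z" for x y z
  proof -
    obtain a b where y: "y \<in> carrier Q" "b \<in> B" "y [^] b = \<one>" "a \<in> A" "x [^] a = y [^] a"
      using R by (auto simp: R_def)
    obtain a' b' where z: "z \<in> carrier Q" "b' \<in> B" "z [^] b' = \<one>" "a' \<in> A" "x [^] a' = z [^] a'"
      using R by (auto simp: R_def)
    have "y [^] (a * a') = z [^] (a * a')"
      using y z x by (metis pow_pow mult.commute)
    \<comment> \<open>\<open>y\<close> and \<open>z\<close> agree after raising to
      \<open>a * a'\<close>. This exponent is invertible modulo \<open>b * b'\<close>, which kills
      both, so it can be undone.\<close>
    moreover have "coprime (a * a') (b * b')" using A B cop y z by blast
    then obtain u where u: "[a * a' * u = 1] (mod b * b')"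
      using cong_solve_coprime_nat[of "a * a'" "b * b'"] by auto
    moreover have "y [^] (b * b') = \<one>" "z [^] (b * b') = \<one>"
      using pow_eq_one_dvd y z by auto
    ultimately show ?thesis
      using pow_cong[OF y(1) _ u] pow_cong[OF z(1) _ u] y z by (metis pow_pow pow_1)
  qed
  have R_ex: "\<exists>y. R x y" if x: "x \<in> carrier Q" for x
  proof -
    obtain a b where ab: "a \<in> A" "b \<in> B" "x [^] (a * b) = \<one>" using tor[OF x] by auto
    \<comment> \<open>The exponent \<open>a * u\<close> is 0 modulo \<open>a\<close> and 1 modulo
      \<open>b\<close>, so this power of \<open>x\<close> loses the \<open>A\<close>-torsion and
      keeps the \<open>B\<close>-torsion.\<close>
    obtain u where u: "[a * u = 1] (mod b)" using cong_solve_coprime_nat[OF cop[OF ab(1,2)]] by auto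
    have "[a * u * a = a] (mod a * b)"
      using u by (metis cong_def mult.commute mult.right_neutral mult_mod_right)
    then have "x [^] a = (x [^] (a * u)) [^] a"
      using pow_cong[OF x ab(3)] x by (simp add: pow_pow cong_sym)
    moreover have "(x [^] (a * u)) [^] b = \<one>"
      using pow_eq_one_dvd[OF x ab(3)] x by (simp add: pow_pow)
    ultimately show ?thesis unfolding R_def using ab x pow_closed by metis
  qed
  define f where "f x = (THE y. R x y)" for x
  have f: "R x (f x)" if "x \<in> carrier Q" for x
    unfolding f_def using R_ex[OF that] R_unique[OF that] by (metis theI')
  have f_eq: "f x = y" if "x \<in> carrier Q" "R x y" for x y
    using R_unique[OF that(1) f[OF that(1)] that(2)] .
  have "f \<in> hom Q Q"
  proof (rule homI)
    fix x assume "x \<in> carrier Q" then show "f x \<in> carrier Q" using f by (simp add: R_def)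
  next
    fix x x' assume x: "x \<in> carrier Q" "x' \<in> carrier Q"
    obtain a b where y: "f x \<in> carrier Q" "b \<in> B" "f x [^] b = \<one>" "a \<in> A" "x [^] a = f x [^] a"
      using f[OF x(1)] by (auto simp: R_def)
    obtain a' b' where z: "f x' \<in> carrier Q" "b' \<in> B" "f x' [^] b' = \<one>" "a' \<in> A"
      "x' [^] a' = f x' [^] a'"
      using f[OF x(2)] by (auto simp: R_def)
    \<comment> \<open>The products \<open>a * a'\<close> and \<open>b * b'\<close> serve both
      elements at once; multiplicativity of the power maps does the rest.\<close>
    have "x [^] (a * a') = f x [^] (a * a')" "x' [^] (a * a') = f x' [^] (a * a')"
      using y z x by (metis pow_pow mult.commute)+
    then have "(x \<otimes> x') [^] (a * a') = (f x \<otimes> f x') [^] (a * a')"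
      using x y z by (simp add: mult_pow)
    moreover have "(f x \<otimes> f x') [^] (b * b') = \<one>"
      using pow_eq_one_dvd[of "f x" b "b * b'"] pow_eq_one_dvd[of "f x'" b' "b * b'"] y z
      by (simp add: mult_pow l_one one_closed)
    ultimately have "R (x \<otimes> x') (f x \<otimes> f x')"
      unfolding R_def using A B y z closed by blast
    then show "f (x \<otimes> x') = f x \<otimes> f x'" using f_eq x closed by blast
  qed
  moreover have "torsion_part A = kernel Q Q f"
  proof -
    have "f x = \<one> \<longleftrightarrow> (\<exists>a \<in> A. x [^] a = \<one>)" if x: "x \<in> carrier Q" for x
    proof -
      have "R x \<one> \<longleftrightarrow> (\<exists>a \<in> A. x [^] a = \<one>)"
        using B one_closed by (auto simp: R_def one_pow)
      then show ?thesis using f[OF x] f_eq[OF x] by metis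
    qed
    then show ?thesis by (auto simp: torsion_part_def kernel_def)
  qed
  ultimately show ?thesis
    using normal_subloopI[OF loop_axioms loop_axioms] by simp
qed

section \<open>Power associativity and p-loops\<close>

lemma powers_group:
  assumes a: "a \<in> carrier Q" and "0 < loop_ord Q a"
  shows "group (Q\<lparr>carrier := range (\<lambda>n::nat. a [^] n)\<rparr>)"
proof (rule groupI; simp)
  show "\<one> \<in> range (\<lambda>n::nat. a [^] n)" using nat_pow_0 by (metis rangeI)
  fix x assume x: "x \<in> range (\<lambda>n::nat. a [^] n)"
  then obtain i :: nat where i: "x = a [^] i" by auto
  show "\<one> \<otimes> x = x" using i a by (simp add: l_one pow_closed)
  \<comment> \<open>Finite order provides the inverse among the nonnegative powers.\<close>
  have "a [^] (i * (loop_ord Q a - 1)) \<otimes> x = a [^] (loop_ord Q a * i)"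
    using i a assms(2) by (auto simp: pow_add[symmetric] algebra_simps gr0_conv_Suc)
  also have "\<dots> = \<one>"
    using pow_eq_one_dvd[OF a pow_loop_ord[OF assms(2)]] by simp
  finally show "\<exists>n::nat. a [^] n \<otimes> x = \<one>" by blast
  fix y assume "y \<in> range (\<lambda>n::nat. a [^] n)"
  then obtain j :: nat where j: "y = a [^] j" by auto
  show "x \<otimes> y \<in> range (\<lambda>n::nat. a [^] n)" using i j a by (simp flip: pow_add)
  fix z assume "z \<in> range (\<lambda>n::nat. a [^] n)"
  then obtain k :: nat where "z = a [^] k" by auto
  then show "x \<otimes> y \<otimes> z = x \<otimes> (y \<otimes> z)"
    unfolding i j by (simp only: pow_add[OF a, symmetric] add.assoc)
qed

text \<open>The powers of \<open>x\<close> form a group, hence a subloop, and lie in every subloop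
  containing \<open>x\<close>; so they are exactly the subloop generated by
  \<open>x\<close>.\<close>

lemma subloop_power_associative:
  assumes H: "subloop H Q" and tor: "torsion_loop Q"
  shows "power_associative (Q\<lparr>carrier := H\<rparr>)"
  unfolding power_associative_def
proof
  fix x assume "x \<in> carrier (Q\<lparr>carrier := H\<rparr>)"
  then have xH: "x \<in> H" and x: "x \<in> carrier Q" using H by (auto simp: subloop_def)
  let ?P = "range (\<lambda>n::nat. x [^] n)"
  have g: "group (Q\<lparr>carrier := ?P\<rparr>)"
    using powers_group[OF x] tor x by (simp add: torsion_loop_def)
  have "subloop ?P (Q\<lparr>carrier := H\<rparr>)"
    using group_imp_loop[OF g] subloop_pow[OF H xH] by (auto simp: subloop_def)
  moreover have "x \<in> ?P" using pow_1[OF x] by (metis rangeI)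
  ultimately have "generated_subloop (Q\<lparr>carrier := H\<rparr>) {x} \<subseteq> ?P"
    by (intro generated_subloop_least) auto
  moreover have "?P \<subseteq> generated_subloop (Q\<lparr>carrier := H\<rparr>) {x}"
    using subloop_pow[of _ "Q\<lparr>carrier := H\<rparr>" x]
    by (auto simp: generated_subloop_def nat_pow_carrier_update)
  ultimately have "generated_subloop (Q\<lparr>carrier := H\<rparr>) {x} = ?P" by auto
  then show "group (Q\<lparr>carrier := H, carrier := generated_subloop (Q\<lparr>carrier := H\<rparr>) {x}\<rparr>)"
    using g by simp
qed

lemma torsion_part_p_loop:
  assumes p: "Factorial_Ring.prime (p::nat)" and H: "subloop (torsion_part (range ((^) p))) Q"
    and tor: "torsion_loop Q"
  shows "p_loop p (Q\<lparr>carrier := torsion_part (range ((^) p))\<rparr>)"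
proof -
  have "\<exists>k. loop_ord Q x = p ^ k" if xt: "x \<in> torsion_part (range ((^) p))" for x
  proof -
    obtain k where "x \<in> carrier Q" "x [^] (p ^ k) = \<one>" using xt by (auto simp: torsion_part_def)
    then have "loop_ord Q x dvd p ^ k" using loop_ord_dvd prime_gt_0_nat[OF p] by simp
    then show ?thesis by (auto simp: divides_primepow_nat[OF p])
  qed
  moreover have "loop (Q\<lparr>carrier := torsion_part (range ((^) p))\<rparr>)"
    using H by (simp add: subloop_def)
  ultimately show ?thesis
    unfolding p_loop_def loop_ord_carrier_update
    using p subloop_power_associative[OF H tor] by (intro conjI ballI) simp_all
qed

end

section \<open>The decomposition\<close>

text \<open>For composite \<open>q\<close> equality may be impossible (\<open>n = 2\<close>,
  \<open>q = 6\<close>), but a multiple of the order is enough to kill an element. Each round strips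
  \<open>gcd n q\<close> from \<open>n\<close> at the cost of one factor \<open>q\<close>.\<close>

lemma dvd_power_mult_coprime:
  fixes n q :: nat
  assumes "0 < n"
  shows "\<exists>k m. coprime m q \<and> n dvd q ^ k * m"
  using assms
proof (induction n rule: less_induct)
  case (less n)
  show ?case
  proof (cases "coprime n q")
    case True
    then show ?thesis by (intro exI[of _ 0] exI[of _ n]) simp
  next
    case False
    obtain n' where n': "n = gcd n q * n'" by (metis dvdE gcd_dvd1)
    have g: "gcd n q \<noteq> 1" "gcd n q \<noteq> 0" using False less.prems by (auto simp: coprime_iff_gcd_eq_1)
    then have "1 < gcd n q" by linarith
    moreover have pos: "0 < n'" using n' less.prems by (cases n') auto
    ultimately have "n' < n" using n' by (metis One_nat_def n_less_m_mult_n)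
    then obtain k m where "coprime m q" "n' dvd q ^ k * m" using less.IH pos by blast
    then have "coprime m q" "n dvd q ^ Suc k * m"
      using n' mult_dvd_mono[of "gcd n q" q n' "q ^ k * m"] by (auto simp: mult.assoc)
    then show ?thesis by blast
  qed
qed

section \<open>The three factors\<close>

context comm_rif_loop
begin

text \<open>The two sets of exponents are closed under products and mutually coprime, and every
  order divides a product of a member of each, so either part is the kernel of the projection to the
  other. The cases q = 2, 3, 6 give the three factors and their complements.\<close>

lemma torsion_part_power_coprime_normal:
  assumes tor: "torsion_loop Q" and q: "1 < q"
  shows "normal_subloop (torsion_part (range ((^) q))) Q"
    and "normal_subloop (torsion_part {m. coprime m q}) Q"
proof -
  have cop: "coprime a b" if "a \<in> range ((^) q)" "b \<in> {m. coprime m q}" for a b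
    using that by (auto simp: coprime_commute)
  have ex: "\<exists>a \<in> range ((^) q). \<exists>b \<in> {m. coprime m q}. x [^] (a * b) = \<one>" if x: "x \<in> carrier Q" for x
  proof -
    have "0 < loop_ord Q x" using tor x by (simp add: torsion_loop_def)
    moreover obtain k m where "coprime m q" "loop_ord Q x dvd q ^ k * m"
      using dvd_power_mult_coprime calculation by blast
    ultimately have "coprime m q" "x [^] (q ^ k * m) = \<one>"
      using pow_eq_one_dvd[OF x pow_loop_ord] by auto
    then show ?thesis by blast
  qed
  have pow: "1 \<in> range ((^) q)" "\<And>a a'. \<lbrakk>a \<in> range ((^) q); a' \<in> range ((^) q)\<rbrakk> \<Longrightarrow> a * a' \<in> range ((^) q)"
    by (auto intro: range_eqI[of _ _ 0]) (metis power_add rangeI)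
  show "normal_subloop (torsion_part (range ((^) q))) Q"
    using pow cop ex by (intro torsion_part_normal[where B = "{m. coprime m q}"]) auto
  show "normal_subloop (torsion_part {m. coprime m q}) Q"
  proof (rule torsion_part_normal[where B = "range ((^) q)"])
    fix x assume "x \<in> carrier Q"
    then show "\<exists>a \<in> {m. coprime m q}. \<exists>b \<in> range ((^) q). x [^] (a * b) = \<one>"
      using ex by (metis mult.commute)
  qed (use pow cop in \<open>auto simp: coprime_commute\<close>)
qed

text \<open>By \<open>left_alt\<close>, both sides of the C law involve \<open>y\<close> only
  through its square n: the law reads x(nz) = (nx)z, which follows from commutativity once n is
  nuclear.\<close>

lemma torsion_part_2_c_loop:
  assumes H: "subloop (torsion_part (range ((^) 2))) Q"
  shows "c_loop (Q\<lparr>carrier := torsion_part (range ((^) 2))\<rparr>)"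
proof -
  interpret H: loop "Q\<lparr>carrier := torsion_part (range ((^) 2))\<rparr>"
    using H by (simp add: subloop_def)
  show ?thesis
  proof (unfold_locales; simp)
    fix x y z
    assume "x \<in> torsion_part (range ((^) 2))" "y \<in> torsion_part (range ((^) 2))"
      "z \<in> torsion_part (range ((^) 2))"
    then obtain k where x: "x \<in> carrier Q" and y: "y \<in> carrier Q" "y [^] ((2::nat) ^ k) = \<one>"
      and z: "z \<in> carrier Q"
      by (auto simp: torsion_part_def)
    obtain u :: nat where "y = (y [^] u) [^] (3::nat)" using exists_root[OF y, of 3] by auto
    then obtain v where v: "v \<in> carrier Q" "y = v [^] (3::nat)" using y pow_closed by metis
    define n where "n = v [^] (6::nat)"
    have n: "n \<in> carrier Q" "y \<otimes> y = n" using v by (auto simp: n_def pow_closed simp flip: pow_add)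
    have nuc: "n \<otimes> (b \<otimes> c) = (n \<otimes> b) \<otimes> c" if "b \<in> carrier Q" "c \<in> carrier Q" for b c
      unfolding n_def using sixth_power_nuclear v that by blast
    have "x \<otimes> (y \<otimes> (y \<otimes> z)) = x \<otimes> (n \<otimes> z)"
      using left_alt[OF y(1) z] n by simp
    also have "\<dots> = n \<otimes> (x \<otimes> z)" using nuc m_comm m_closed n(1) x z by metis
    also have "\<dots> = (n \<otimes> x) \<otimes> z" using nuc x z by simp
    also have "n \<otimes> x = (x \<otimes> y) \<otimes> y" using left_alt[OF y(1) x] n m_comm m_closed x y by metis
    finally show "x \<otimes> (y \<otimes> (y \<otimes> z)) = x \<otimes> y \<otimes> y \<otimes> z" .
  qed
qed

text \<open>Under commutativity the four Moufang identities reduce to the two forms in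
  \<open>ml\<close>, each yielding two of them. Only the repeated variable has to be a
  square.\<close>

lemma torsion_part_3_moufang_loop:
  assumes H: "subloop (torsion_part (range ((^) 3))) Q"
  shows "moufang_loop (Q\<lparr>carrier := torsion_part (range ((^) 3))\<rparr>)"
proof -
  have ml: "x \<otimes> (x \<otimes> (y \<otimes> z)) = (x \<otimes> y) \<otimes> (x \<otimes> z)" "x \<otimes> (y \<otimes> (x \<otimes> z)) = (x \<otimes> (x \<otimes> y)) \<otimes> z"
    if xt: "x \<in> torsion_part (range ((^) 3))" and y: "y \<in> carrier Q" and z: "z \<in> carrier Q" for x y z
  proof -
    obtain k where x: "x \<in> carrier Q" "x [^] ((3::nat) ^ k) = \<one>"
      using xt by (auto simp: torsion_part_def)
    obtain u :: nat where "x = (x [^] u) [^] (2::nat)" using exists_root[OF x, of 2] by auto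
    then obtain v where v: "v \<in> carrier Q" "x = v \<otimes> v" using x pow_closed pow_2 by metis
    show "x \<otimes> (x \<otimes> (y \<otimes> z)) = (x \<otimes> y) \<otimes> (x \<otimes> z)"
      unfolding v(2) using square_moufang[OF v(1) y z] by simp
    show "x \<otimes> (y \<otimes> (x \<otimes> z)) = (x \<otimes> (x \<otimes> y)) \<otimes> z"
      unfolding v(2) by (rule square_moufang_middle[OF v(1) y z])
  qed
  interpret H: loop "Q\<lparr>carrier := torsion_part (range ((^) 3))\<rparr>"
    using H by (simp add: subloop_def)
  have sub: "x \<in> carrier Q" if "x \<in> torsion_part (range ((^) 3))" for x
    using that by (simp add: torsion_part_def)
  show ?thesis
  proof (unfold_locales; simp)
    fix x y z
    assume xyz: "x \<in> torsion_part (range ((^) 3))" "y \<in> torsion_part (range ((^) 3))"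
      "z \<in> torsion_part (range ((^) 3))"
    note c = xyz[THEN sub]
    show "x \<otimes> (y \<otimes> z \<otimes> x) = x \<otimes> y \<otimes> (z \<otimes> x)"
      using ml(1)[OF xyz(1) c(2,3)] m_comm[OF c(1,3)] m_comm[OF c(1) m_closed[OF c(2,3)]] by simp
    then show "x \<otimes> (y \<otimes> z) \<otimes> x = x \<otimes> y \<otimes> (z \<otimes> x)"
      using m_comm m_closed c by metis
    show "x \<otimes> (y \<otimes> (x \<otimes> z)) = x \<otimes> y \<otimes> x \<otimes> z"
      using ml(2)[OF xyz(1) c(2,3)] m_comm[OF c(1) m_closed[OF c(1,2)]] by simp
    then show "z \<otimes> x \<otimes> y \<otimes> x = z \<otimes> (x \<otimes> (y \<otimes> x))"
      using m_comm m_closed c by metis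
  qed
qed

lemma torsion_part_coprime_6:
  assumes H: "subloop (torsion_part {m. coprime m 6}) Q"
  shows "comm_group (Q\<lparr>carrier := torsion_part {m. coprime m 6}\<rparr>)"
    and "x \<in> torsion_part {m. coprime m 6} \<Longrightarrow> coprime (loop_ord Q x) 6"
proof -
  let ?H = "torsion_part {m. coprime m 6}"
  have sub: "x \<in> carrier Q" if "x \<in> ?H" for x
    using that by (simp add: torsion_part_def)
  have assoc: "x \<otimes> (y \<otimes> z) = (x \<otimes> y) \<otimes> z"
    if xt: "x \<in> ?H" and yz: "y \<in> carrier Q" "z \<in> carrier Q" for x y z
  proof -
    obtain m :: nat where x: "x \<in> carrier Q" "x [^] m = \<one>" "coprime m 6"
      using xt by (auto simp: torsion_part_def)
    obtain u :: nat where "x = (x [^] u) [^] (6::nat)"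
      using exists_root[OF x(1,2), of 6] x(3) by (auto simp: coprime_commute)
    then show ?thesis using sixth_power_nuclear[OF pow_closed[OF x(1)] yz] by metis
  qed
  show "comm_group (Q\<lparr>carrier := ?H\<rparr>)"
  proof (rule comm_groupI; simp)
    show "\<one> \<in> ?H" using H by (rule subloop_one)
    fix x assume x: "x \<in> ?H"
    show "\<one> \<otimes> x = x" using sub[OF x] l_one by simp
    show "\<exists>y \<in> ?H. y \<otimes> x = \<one>"
      using subloop_right_inverse[OF H x] m_comm sub x by metis
    fix y assume y: "y \<in> ?H"
    show "x \<otimes> y \<in> ?H" using subloop_mult[OF H x y] .
    show "x \<otimes> y = y \<otimes> x" using m_comm sub x y by simp
    fix z assume "z \<in> ?H"
    then show "x \<otimes> y \<otimes> z = x \<otimes> (y \<otimes> z)" using assoc x y sub by simp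
  qed
  assume "x \<in> ?H"
  then obtain m :: nat where m: "x \<in> carrier Q" "x [^] m = \<one>" "coprime m 6"
    by (auto simp: torsion_part_def)
  \<comment> \<open>\<open>loop_ord_dvd\<close> needs a positive exponent; 0 is excluded because its
    gcd with 6 is 6.\<close>
  have "m \<noteq> 0" using m(3) by (intro notI) simp
  then have "loop_ord Q x dvd m" using loop_ord_dvd m by simp
  then show "coprime (loop_ord Q x) 6" using coprime_divisors[of "loop_ord Q x" m 6 6] m(3) by simp
qed

text \<open>\<open>K\<close> ranges over the subloops whose intersection is the generated subloop.
  Splitting the order at 6 and then 6^k into 2^k and 3^k writes each element as (vw)t with one
  factor from each part.\<close>

lemma torsion_decomposition:
  assumes tor: "torsion_loop Q" and K: "subloop K Q"
    and sub: "torsion_part (range ((^) 2)) \<subseteq> K" "torsion_part (range ((^) 3)) \<subseteq> K"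
      "torsion_part {m. coprime m 6} \<subseteq> K"
  shows "carrier Q \<subseteq> K"
proof
  fix x assume x: "x \<in> carrier Q"
  then have ord: "0 < loop_ord Q x" using tor by (simp add: torsion_loop_def)
  then obtain k m where m: "coprime m 6" "loop_ord Q x dvd 6 ^ k * m"
    using dvd_power_mult_coprime by blast
  then have "x [^] (6 ^ k * m) = \<one>" using pow_eq_one_dvd[OF x pow_loop_ord[OF ord]] by blast
  moreover have "coprime (6 ^ k) m" using m(1) by (simp add: coprime_commute)
  ultimately obtain s t where st: "s \<in> carrier Q" "t \<in> carrier Q" "x = s \<otimes> t"
    "s [^] ((6::nat) ^ k) = \<one>" "t [^] m = \<one>"
    using coprime_decomposition[OF x] by metis
  have "s [^] ((2::nat) ^ k * 3 ^ k) = \<one>" using st(4) by (simp flip: power_mult_distrib)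
  moreover have "coprime ((2::nat) ^ k) (3 ^ k)" by simp
  ultimately obtain v w where vw: "v \<in> carrier Q" "w \<in> carrier Q" "s = v \<otimes> w"
    "v [^] ((2::nat) ^ k) = \<one>" "w [^] ((3::nat) ^ k) = \<one>"
    using coprime_decomposition[OF st(1)] by metis
  have "v \<in> K" "w \<in> K" "t \<in> K"
    using sub vw st m(1) by (auto simp: torsion_part_def)
  then show "x \<in> K" using st(3) vw(3) subloop_mult[OF K] by simp
qed

end

theorem theorem4p8:
  fixes Q :: "('a, 'b) monoid_scheme"
  assumes "rif_loop Q" and "comm_loop Q" and "torsion_loop Q"
  shows "\<exists>H :: nat \<Rightarrow> 'a set.
    internal_direct_product Q {1, 2, 3} H \<and>
    c_loop (Q\<lparr>carrier := H 1\<rparr>) \<and> p_loop 2 (Q\<lparr>carrier := H 1\<rparr>) \<and>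
    moufang_loop (Q\<lparr>carrier := H 2\<rparr>) \<and> p_loop 3 (Q\<lparr>carrier := H 2\<rparr>) \<and>
    comm_group (Q\<lparr>carrier := H 3\<rparr>) \<and>
    (\<forall>x \<in> H 3. coprime (loop_ord (Q\<lparr>carrier := H 3\<rparr>) x) 6)"
proof -
  interpret comm_rif_loop Q
    using assms(1,2) by (simp add: comm_rif_loop_def)
  note tor = assms(3)
  define A where "A i = (if i = 1 then range ((^) 2) else if i = 2 then range ((^) 3)
    else {m::nat. coprime m 6})" for i :: nat
  \<comment> \<open>\<open>B i\<close> describes a complement of \<open>H i\<close>: its torsion
    part is a subloop containing the other two factors, hence all they generate, and coprime
    exponents force it to meet \<open>H i\<close> trivially.\<close>
  define B where "B i = (if i = 1 then {m. coprime m 2} else if i = 2 then {m. coprime m 3}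
    else range ((^) (6::nat)))" for i :: nat
  define H where "H i = torsion_part (A i)" for i
  have normal: "normal_subloop (H i) Q" "normal_subloop (torsion_part (B i)) Q" for i
    unfolding H_def A_def B_def
    using torsion_part_power_coprime_normal[OF tor] by (auto simp del: coprime_right_2_iff_odd)
  have sub: "subloop (H i) Q" "subloop (torsion_part (B i)) Q" for i
    using normal by (auto simp: normal_subloop_def)
  have cop: "coprime a b" if "a \<in> A i" "b \<in> B i" for a b i
    using that by (auto simp: A_def B_def coprime_commute split: if_splits)
  have cop2: "coprime m 2" "coprime m 3" if "coprime m 6" for m :: nat
    using that coprime_mult_right_iff[of m 2 3] by auto
  have six: "\<exists>k'. (2::nat) ^ k dvd 6 ^ k'" "\<exists>k'. (3::nat) ^ k dvd 6 ^ k'" for k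
    by (auto intro!: exI[of _ k] dvd_power_same)
  have HB: "H j \<subseteq> torsion_part (B i)" if ij: "i \<in> {1,2,3}" "j \<in> {1,2,3}" "i \<noteq> j" for i j
  proof
    fix x assume "x \<in> H j"
    then obtain a where a: "x \<in> carrier Q" "a \<in> A j" "x [^]\<^bsub>Q\<^esub> a = \<one>\<^bsub>Q\<^esub>"
      by (auto simp: H_def torsion_part_def)
    \<comment> \<open>A power of 2 or 3 need not be a power of 6 but divides one; for the other two
      values of \<open>i\<close> the exponent \<open>a\<close> itself lies in
      \<open>B i\<close>.\<close>
    have "\<exists>b \<in> B i. a dvd b"
    proof (cases "i = 3")
      case True
      then show ?thesis using a(2) ij six by (auto simp: A_def B_def)
    next
      case False
      then have "a \<in> B i" using a(2) ij cop2 by (auto simp: A_def B_def)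
      then show ?thesis by (rule bexI[rotated]) simp
    qed
    then show "x \<in> torsion_part (B i)"
      using a pow_eq_one_dvd by (auto simp: torsion_part_def)
  qed
  have "internal_direct_product Q {1, 2, 3} H"
    unfolding internal_direct_product_def
  proof (intro conjI ballI)
    fix i :: nat assume i: "i \<in> {1, 2, 3}"
    show "normal_subloop (H i) Q" by (rule normal)
    have "(\<Union>j \<in> {1, 2, 3} - {i}. H j) \<subseteq> torsion_part (B i)"
      using HB[OF i] by blast
    then have "generated_subloop Q (\<Union>j \<in> {1, 2, 3} - {i}. H j) \<subseteq> torsion_part (B i)"
      using sub by (intro generated_subloop_least)
    moreover have "H i \<inter> torsion_part (B i) \<subseteq> {\<one>\<^bsub>Q\<^esub>}"
      unfolding H_def using cop by (rule torsion_part_disjoint)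
    ultimately show "H i \<inter> generated_subloop Q (\<Union>j \<in> {1, 2, 3} - {i}. H j) = {\<one>\<^bsub>Q\<^esub>}"
      using subloop_one[OF sub(1)] one_in_generated_subloop by fast
  next
    have self: "subloop (carrier Q) Q" using loop_axioms by (simp add: subloop_def)
    have "carrier Q \<subseteq> K" if "subloop K Q" "(\<Union>i \<in> {1, 2, 3}. H i) \<subseteq> K" for K
      using that by (intro torsion_decomposition[OF tor]) (auto simp: H_def A_def)
    moreover have "generated_subloop Q (\<Union>i \<in> {1, 2, 3}. H i) \<subseteq> carrier Q"
      using self by (intro generated_subloop_least) (auto simp: H_def torsion_part_def)
    ultimately show "carrier Q = generated_subloop Q (\<Union>i \<in> {1, 2, 3}. H i)"
      by (auto simp: generated_subloop_def)
  qed
  moreover have "c_loop (Q\<lparr>carrier := H 1\<rparr>)" "p_loop 2 (Q\<lparr>carrier := H 1\<rparr>)"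
    using torsion_part_2_c_loop torsion_part_p_loop[OF two_is_prime_nat _ tor] sub(1)[of 1]
    by (auto simp: H_def A_def)
  moreover have "moufang_loop (Q\<lparr>carrier := H 2\<rparr>)" "p_loop 3 (Q\<lparr>carrier := H 2\<rparr>)"
    using torsion_part_3_moufang_loop torsion_part_p_loop[of 3, OF _ _ tor] sub(1)[of 2]
    by (auto simp: H_def A_def)
  moreover have "comm_group (Q\<lparr>carrier := H 3\<rparr>)"
    "\<forall>x \<in> H 3. coprime (loop_ord (Q\<lparr>carrier := H 3\<rparr>) x) 6"
    using torsion_part_coprime_6 sub(1)[of 3]
    by (auto simp: H_def A_def loop_ord_carrier_update)
  ultimately show ?thesis by (intro exI[of _ H]) simp
qed

end
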